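(* For any diagonal section $\delta$ with $\delta\ne\delta_M$ (where $\delta_M(x)=x$ for all $x\in[0,1]$), $$\mu_\delta=\max\{\widehat{\delta}(x): x\in[0,1],\ (x,g^\delta_U(x))\in H_\delta,\ g^\delta_U(x)>x\}.$$
   Context: $\mathbb{I}=[0,1]$. A (bivariate) copula is a function $C\colon\mathbb{I}^2\to\mathbb{I}$ with $C(x,0)=C(0,y)=0$, $C(x,1)=x$, $C(1,y)=y$, and $C(b,d)+C(a,c)-C(b,c)-C(a,d)\ge 0$ for all $a\le b$, $c\le d$. A diagonal section is $\delta\colon\mathbb{I}\to\mathbb{I}$ with $\delta(x)\le x$, $0\le\delta(y)-\delta(x)\le 2(y-x)$ for $x\le y$, $\delta(1)=1$; $\widehat{\delta}(x)=x-\delta(x)$. The asymmetry of a copula is $\mu(C)=\max_{x,y}|C(x,y)-C(y,x)|$ and $\mu_\delta=\sup\{\mu(C): C\text{ copula with } C(t,t)=\delta(t)\ \forall t\}$. For $x\le y$ let $\mathrm{TV}_x^y(\widehat{\delta})$ be the total variation of $\widehat{\delta}$ on $[x,y]$, and $\mathrm{TV}_x^y=-\mathrm{TV}_y^x$ for $y<x$. Let $f^\delta(x,y)=y-\frac12(\widehat{\delta}(x)+\widehat{\delta}(y)+\mathrm{TV}_x^y(\widehat{\delta}))$, $D_f^\circ(\delta)=\{(x,y)\in\mathbb{I}^2: f^\delta(x,y)<\min\{x,y\}\}$, $D_f(\delta)=\overline{D_f^\circ(\delta)}\cup\{(x,x):x\in\mathbb{I}\}$, $g^\delta_U(x)=\max\{y:(x,y)\in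 D_f(\delta)\}$. Define $h^\delta(x)=\max\{y\in\mathbb{I}: y\ge x,\ \widehat{\delta}(t)\ge\widehat{\delta}(x)\ \text{for all } t\in[x,y]\}$, let $Z_\delta$ be the set of discontinuity points of $h^\delta$, and $H_\delta=\{(x,h^\delta(x)):x\in\mathbb{I}\}\cup\bigcup_{x\in Z_\delta}\big(\{x\}\times[\liminf_{t\to x}h^\delta(t),h^\delta(x)]\big)$. *)

theory Defs
  imports "HOL-Analysis.Analysis" "HOL-Library.Extended_Real"
begin

definition II :: "real set" where "II = {0..1}"

definition is_copula :: "(real \<Rightarrow> real \<Rightarrow> real) \<Rightarrow> bool" where
  "is_copula C \<longleftrightarrow>
     (\<forall>x\<in>II. \<forall>y\<in>II. C x y \<in> II) \<and>
     (\<forall>x\<in>II. C x 0 = 0 \<and> C 0 x = 0 \<and> C x 1 = x \<and> C 1 x = x) \<and>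
     (\<forall>a\<in>II. \<forall>b\<in>II. \<forall>c\<in>II. \<forall>d\<in>II. a \<le> b \<longrightarrow> c \<le> d \<longrightarrow>
        C b d + C a c - C b c - C a d \<ge> 0)"

definition is_diagonal :: "(real \<Rightarrow> real) \<Rightarrow> bool" where
  "is_diagonal \<delta> \<longleftrightarrow>
     (\<forall>x\<in>II. \<delta> x \<in> II \<and> \<delta> x \<le> x) \<and>
     (\<forall>x\<in>II. \<forall>y\<in>II. x \<le> y \<longrightarrow> 0 \<le> \<delta> y - \<delta> x \<and> \<delta> y - \<delta> x \<le> 2 * (y - x)) \<and>
     \<delta> 1 = 1"

definition dhat :: "(real \<Rightarrow> real) \<Rightarrow> real \<Rightarrow> real" where
  "dhat \<delta> x = x - \<delta> x"

definition asym :: "(real \<Rightarrow> real \<Rightarrow> real) \<Rightarrow> real" where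
  "asym C = Sup {\<bar>C x y - C y x\<bar> | x y. x \<in> II \<and> y \<in> II}"

definition mu_diag :: "(real \<Rightarrow> real) \<Rightarrow> real" where
  "mu_diag \<delta> = Sup {asym C | C. is_copula C \<and> (\<forall>t\<in>II. C t t = \<delta> t)}"

definition total_var :: "(real \<Rightarrow> real) \<Rightarrow> real \<Rightarrow> real \<Rightarrow> real" where
  "total_var f a b = Sup {(\<Sum>i<n. \<bar>f (p (Suc i)) - f (p i)\<bar>) | p n.
       p 0 = a \<and> p n = b \<and> (\<forall>i<n. p i \<le> p (Suc i))}"

definition TV :: "(real \<Rightarrow> real) \<Rightarrow> real \<Rightarrow> real \<Rightarrow> real" where
  "TV f x y = (if x \<le> y then total_var f x y else - total_var f y x)"

definition f_delta :: "(real \<Rightarrow> real) \<Rightarrow> real \<Rightarrow> real \<Rightarrow> real" where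
  "f_delta \<delta> x y = y - (dhat \<delta> x + dhat \<delta> y + TV (dhat \<delta>) x y) / 2"

definition Df_open :: "(real \<Rightarrow> real) \<Rightarrow> (real \<times> real) set" where
  "Df_open \<delta> = {(x, y). x \<in> II \<and> y \<in> II \<and> f_delta \<delta> x y < min x y}"

definition Df :: "(real \<Rightarrow> real) \<Rightarrow> (real \<times> real) set" where
  "Df \<delta> = closure (Df_open \<delta>) \<union> {(x, x) | x. x \<in> II}"

text \<open>g_U(x) = max{y. (x,y) \<in> D_f}; D_f is compact, so the supremum is the maximum.\<close>
definition gU :: "(real \<Rightarrow> real) \<Rightarrow> real \<Rightarrow> real" where
  "gU \<delta> x = Sup {y. (x, y) \<in> Df \<delta>}"

text \<open>h(x) = max{y \<in> I. y \<ge> x, dhat t \<ge> dhat x on [x,y]}; the set is a closed interval.\<close>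
definition h_delta :: "(real \<Rightarrow> real) \<Rightarrow> real \<Rightarrow> real" where
  "h_delta \<delta> x = Sup {y \<in> II. y \<ge> x \<and> (\<forall>t\<in>{x..y}. dhat \<delta> t \<ge> dhat \<delta> x)}"

definition Z_delta :: "(real \<Rightarrow> real) \<Rightarrow> real set" where
  "Z_delta \<delta> = {x \<in> II. \<not> continuous (at x within II) (h_delta \<delta>)}"

definition liminf_h :: "(real \<Rightarrow> real) \<Rightarrow> real \<Rightarrow> real" where
  "liminf_h \<delta> x = real_of_ereal (Liminf (at x within II) (\<lambda>t. ereal (h_delta \<delta> t)))"

definition H_delta :: "(real \<Rightarrow> real) \<Rightarrow> (real \<times> real) set" where
  "H_delta \<delta> = {(x, h_delta \<delta> x) | x. x \<in> II} \<union>
     (\<Union>x\<in>Z_delta \<delta>. {x} \<times> {liminf_h \<delta> x .. h_delta \<delta> x})"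

end

theory Submission
  imports Defs
begin

text \<open>
  Write \<open>d = dhat \<delta>\<close> and let \<open>V\<close> be its variation function. Then \<open>f_delta \<delta> x y\<close> splits as
  \<open>x + beta y - eta x\<close> with \<open>beta\<close> and \<open>eta\<close> nondecreasing. For \<open>x \<le> y\<close> every copula \<open>C\<close> with
  diagonal section \<open>\<delta>\<close> satisfies \<open>C x y \<le> min x (f_delta \<delta> x y)\<close> and
  \<open>C y x \<ge> x - min d\<close>, the minimum being over \<open>[x, y]\<close>. Gluing these two bounds along the diagonal
  gives a copula again, so \<open>mu_diag \<delta>\<close> is the maximum over \<open>x \<le> y\<close> of
  \<open>min d + min 0 (beta y - eta x)\<close>. For fixed \<open>x\<close> this is largest at \<open>y = gU \<delta> x\<close>, where
  \<open>beta y = eta x\<close>, so that the value is the minimum of \<open>d\<close> over \<open>[x, gU \<delta> x]\<close>. Shifting an optimal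
  \<open>x\<close> to the left makes this minimum equal to \<open>d x\<close>, i.e. \<open>gU \<delta> x \<le> h_delta \<delta> x\<close>, and the rightmost such
  \<open>x\<close> satisfies \<open>(x, gU \<delta> x) \<in> H_delta \<delta>\<close>.
\<close>

section \<open>Total variation\<close>

definition variation_sums :: "(real \<Rightarrow> real) \<Rightarrow> real \<Rightarrow> real \<Rightarrow> real set" where
  "variation_sums f a b = {(\<Sum>i<n. \<bar>f (p (Suc i)) - f (p i)\<bar>) | p n.
       p 0 = a \<and> p n = b \<and> (\<forall>i<n. p i \<le> p (Suc i))}"

lemma total_var_eq_Sup: "total_var f a b = Sup (variation_sums f a b)"
  by (simp add: total_var_def variation_sums_def)

text \<open>Peeling off the last partition point reduces a bound on all variation sums to a single
  step from \<open>b\<close> to \<open>c\<close>.\<close>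

lemma variation_sums_induct [consumes 1, case_names refl step]:
  assumes "s \<in> variation_sums f a b"
    and "P a 0"
    and "\<And>b c s. a \<le> b \<Longrightarrow> b \<le> c \<Longrightarrow> s \<in> variation_sums f a b \<Longrightarrow> P b s \<Longrightarrow> P c (s + \<bar>f c - f b\<bar>)"
  shows "P b s"
proof -
  obtain p n where p: "p 0 = a" "p n = b" "\<forall>i<n. p i \<le> p (Suc i)"
    and s: "s = (\<Sum>i<n. \<bar>f (p (Suc i)) - f (p i)\<bar>)"
    using assms(1) by (auto simp: variation_sums_def)
  have "k \<le> n \<Longrightarrow> a \<le> p k \<and> P (p k) (\<Sum>i<k. \<bar>f (p (Suc i)) - f (p i)\<bar>)" for k
  proof (induction k)
    case 0
    then show ?case using assms(2) p(1) by simp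
  next
    case (Suc k)
    have "(\<Sum>i<k. \<bar>f (p (Suc i)) - f (p i)\<bar>) \<in> variation_sums f a (p k)"
      unfolding variation_sums_def using Suc.prems p by (intro CollectI exI[of _ p] exI[of _ k]) auto
    moreover have "p k \<le> p (Suc k)"
      using p(3) Suc.prems by simp
    ultimately show ?case
      using assms(3)[of "p k" "p (Suc k)"] Suc by fastforce
  qed
  then show ?thesis
    using p(2) s by blast
qed

lemma variation_sums_append:
  assumes "s \<in> variation_sums f a b" "t \<in> variation_sums f b c"
  shows "s + t \<in> variation_sums f a c"
proof -
  obtain p n where p: "p 0 = a" "p n = b" "\<forall>i<n. p i \<le> p (Suc i)"
    and s: "s = (\<Sum>i<n. \<bar>f (p (Suc i)) - f (p i)\<bar>)"
    using assms(1) by (auto simp: variation_sums_def)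
  obtain q m where q: "q 0 = b" "q m = c" "\<forall>i<m. q i \<le> q (Suc i)"
    and t: "t = (\<Sum>i<m. \<bar>f (q (Suc i)) - f (q i)\<bar>)"
    using assms(2) by (auto simp: variation_sums_def)
  define r where "r i = (if i \<le> n then p i else q (i - n))" for i
  have r_left: "r i = p i" if "i \<le> n" for i
    using that by (simp add: r_def)
  have r_right: "r (n + j) = q j" for j
    using p q by (simp add: r_def)
  have "r i \<le> r (Suc i)" if "i < n + m" for i
  proof (cases "i < n")
    case True
    then show ?thesis using p(3) by (simp add: r_left)
  next
    case False
    then have "q (i - n) \<le> q (Suc (i - n))"
      using q(3) that by simp
    then show ?thesis
      using r_right[of "i - n"] r_right[of "Suc (i - n)"] False by simp
  qed
  moreover have "s + t = (\<Sum>i<n+m. \<bar>f (r (Suc i)) - f (r i)\<bar>)"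
  proof -
    have "(\<Sum>i<n+m. \<bar>f (r (Suc i)) - f (r i)\<bar>)
        = (\<Sum>i<n. \<bar>f (r (Suc i)) - f (r i)\<bar>) + (\<Sum>j<m. \<bar>f (r (Suc (n + j))) - f (r (n + j))\<bar>)"
      by (induction m) auto
    moreover have "(\<Sum>i<n. \<bar>f (r (Suc i)) - f (r i)\<bar>) = s"
      unfolding s by (intro sum.cong) (auto simp: r_left)
    moreover have "(\<Sum>j<m. \<bar>f (r (Suc (n + j))) - f (r (n + j))\<bar>) = t"
      unfolding t using r_right by (intro sum.cong) (auto simp flip: add_Suc_right)
    ultimately show ?thesis by simp
  qed
  ultimately show ?thesis
    unfolding variation_sums_def using p q r_left[of 0] r_right[of m]
    by (intro CollectI exI[of _ r] exI[of _ "n + m"]) auto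
qed

lemma abs_diff_in_variation_sums:
  assumes "a \<le> b"
  shows "\<bar>f b - f a\<bar> \<in> variation_sums f a b"
  unfolding variation_sums_def using assms
  by (intro CollectI exI[of _ "\<lambda>i. if i = 0 then a else b"] exI[of _ "1::nat"]) auto

lemma variation_sums_le:
  assumes "s \<in> variation_sums f a b" and lip: "L-lipschitz_on {a..b} f"
  shows "s \<le> L * (b - a)"
proof -
  have "c \<le> b \<longrightarrow> s' \<le> L * (c - a)" if "s' \<in> variation_sums f a c" for c s'
    using that
  proof (induction rule: variation_sums_induct)
    case (step u v r)
    show ?case
    proof
      assume "v \<le> b"
      then have "\<bar>f v - f u\<bar> \<le> L * (v - u)"
        using lipschitz_onD[OF lip, of v u] step by (simp add: dist_real_def)
      then show "r + \<bar>f v - f u\<bar> \<le> L * (v - a)"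
        using step \<open>v \<le> b\<close> by (simp add: algebra_simps)
    qed
  qed simp
  then show ?thesis using assms(1) by blast
qed

lemma total_var_le:
  assumes "a \<le> b" and "\<And>s. s \<in> variation_sums f a b \<Longrightarrow> s \<le> B"
  shows "total_var f a b \<le> B"
  unfolding total_var_eq_Sup
  using assms abs_diff_in_variation_sums by (intro cSup_least) blast+

text \<open>The Lipschitz condition bounds the sums, so that \<open>Sup\<close> is a genuine
  supremum.\<close>

lemma variation_sum_le_total_var:
  assumes "L-lipschitz_on {a..b} f" and "s \<in> variation_sums f a b"
  shows "s \<le> total_var f a b"
  unfolding total_var_eq_Sup
  using assms variation_sums_le by (intro cSup_upper bdd_aboveI) blast+

lemma total_var_superadditive:
  assumes "a \<le> b" "b \<le> c" and lip: "L-lipschitz_on {a..c} f"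
  shows "total_var f a b + total_var f b c \<le> total_var f a c"
proof -
  have "s + t \<le> total_var f a c" if "s \<in> variation_sums f a b" "t \<in> variation_sums f b c" for s t
    using variation_sums_append[OF that] variation_sum_le_total_var[OF lip] by blast
  then have "total_var f a b \<le> total_var f a c - t" if "t \<in> variation_sums f b c" for t
    using that assms by (intro total_var_le) (auto simp: le_diff_eq)
  then have "total_var f b c \<le> total_var f a c - total_var f a b"
    using assms by (intro total_var_le) (auto simp: le_diff_eq add.commute)
  then show ?thesis by simp
qed

lemma total_var_additive:
  assumes "a \<le> b" "b \<le> c" and lip: "L-lipschitz_on {a..c} f"
  shows "total_var f a c = total_var f a b + total_var f b c"
proof (rule antisym)
  have sub: "L-lipschitz_on {u..v} f" if "a \<le> u" "v \<le> c" for u v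
    using lipschitz_on_subset[OF lip] that by auto
  have diff: "\<bar>f v - f u\<bar> \<le> total_var f u v" if "a \<le> u" "u \<le> v" "v \<le> c" for u v
    using that by (intro variation_sum_le_total_var[OF sub] abs_diff_in_variation_sums)
  \<comment> \<open>Subadditivity: a cut point before the last step falls under the induction
    hypothesis; one inside the last step is inserted by the triangle inequality.\<close>
  have "\<forall>b. a \<le> b \<longrightarrow> b \<le> z \<longrightarrow> z \<le> c \<longrightarrow> s \<le> total_var f a b + total_var f b z"
    if "s \<in> variation_sums f a z" for s z
    using that
  proof (induction rule: variation_sums_induct)
    case refl
    show ?case
      using diff[of a a] by force
  next
    case (step u v s)
    show ?case
    proof (intro allI impI)
      fix b assume b: "a \<le> b" "b \<le> v" "v \<le> c"
      show "s + \<bar>f v - f u\<bar> \<le> total_var f a b + total_var f b v"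
      proof (cases "b \<le> u")
        case True
        then show ?thesis
          using step b diff[of u v] total_var_superadditive[OF True step(2) sub] by force
      next
        case False
        have "s \<le> total_var f a u"
          using step b by (intro variation_sum_le_total_var[OF sub]) auto
        moreover have "\<bar>f v - f u\<bar> \<le> \<bar>f b - f u\<bar> + \<bar>f v - f b\<bar>"
          by simp
        ultimately show ?thesis
          using step b False diff[of u b] diff[of b v] total_var_superadditive[OF step(1) _ sub, of b] by force
      qed
    qed
  qed
  then show "total_var f a c \<le> total_var f a b + total_var f b c"
    using assms by (intro total_var_le) auto
qed (use total_var_superadditive assms in blast)

section \<open>Copulas\<close>

lemma copula_boundary:
  assumes "is_copula C" "x \<in> II"
  shows "C x 0 = 0" "C 0 x = 0" "C x 1 = x" "C 1 x = x"
  using assms by (auto simp: is_copula_def)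

lemma copula_rectangle:
  assumes "is_copula C" "0 \<le> a" "a \<le> b" "b \<le> 1" "0 \<le> c" "c \<le> d" "d \<le> 1"
  shows "C b c + C a d \<le> C b d + C a c"
proof -
  have "C b d + C a c - C b c - C a d \<ge> 0"
    using assms unfolding is_copula_def II_def by auto
  then show ?thesis by simp
qed

text \<open>Transposition carries one-sided statements over to the other argument and to the other
  side of the diagonal.\<close>

lemma copula_swap:
  assumes "is_copula C"
  shows "is_copula (\<lambda>x y. C y x)"
  unfolding is_copula_def
proof (intro conjI ballI impI)
  fix a b c d assume "a \<in> II" "b \<in> II" "c \<in> II" "d \<in> II" "a \<le> b" "c \<le> d"
  then show "C d b + C c a - C c b - C d a \<ge> 0"
    using copula_rectangle[OF assms, of c d a b] by (auto simp: II_def)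
qed (use assms in \<open>auto simp: is_copula_def\<close>)

text \<open>These are the rectangle inequalities on \<open>[x, x'] \<times> [0, y]\<close> and on
  \<open>[x, x'] \<times> [y, 1]\<close>.\<close>

lemma copula_lipschitz_fst:
  assumes "is_copula C" "0 \<le> x" "x \<le> x'" "x' \<le> 1" "y \<in> II"
  shows "C x y \<le> C x' y" "C x' y - C x y \<le> x' - x"
proof -
  have "x \<in> II" "x' \<in> II" "0 \<le> y" "y \<le> 1"
    using assms by (auto simp: II_def)
  then show "C x y \<le> C x' y" "C x' y - C x y \<le> x' - x"
    using copula_rectangle[OF assms(1-4), of 0 y] copula_rectangle[OF assms(1-4), of y 1]
      copula_boundary[OF assms(1)] by force+
qed

lemma copula_lipschitz:
  assumes C: "is_copula C" and II: "x \<in> II" "y \<in> II" "x' \<in> II" "y' \<in> II"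
  shows "\<bar>C x' y' - C x y\<bar> \<le> \<bar>x' - x\<bar> + \<bar>y' - y\<bar>"
proof -
  have fst: "\<bar>C u' v - C u v\<bar> \<le> \<bar>u' - u\<bar>"
    if C: "is_copula C" and II: "u \<in> II" "u' \<in> II" "v \<in> II" for C u u' v
    using copula_lipschitz_fst[OF C, of u u' v] copula_lipschitz_fst[OF C, of u' u v] II
    by (cases "u \<le> u'") (auto simp: II_def)
  show ?thesis
    using fst[OF C II(1,3,4)] fst[OF copula_swap[OF C] II(2,4,1)] by linarith
qed

lemma continuous_on_copula:
  assumes "is_copula C"
  shows "continuous_on (II \<times> II) (\<lambda>z. C (fst z) (snd z))"
proof (rule lipschitz_on_continuous_on)
  show "2-lipschitz_on (II \<times> II) (\<lambda>z. C (fst z) (snd z))"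
  proof (rule lipschitz_onI)
    fix z w :: "real \<times> real" assume "z \<in> II \<times> II" "w \<in> II \<times> II"
    then have "\<bar>C (fst z) (snd z) - C (fst w) (snd w)\<bar> \<le> \<bar>fst z - fst w\<bar> + \<bar>snd z - snd w\<bar>"
      by (intro copula_lipschitz[OF assms]) auto
    also have "\<dots> \<le> 2 * dist z w"
      using dist_fst_le[of z w] dist_snd_le[of z w] by (simp add: dist_real_def)
    finally show "dist (C (fst z) (snd z)) (C (fst w) (snd w)) \<le> 2 * dist z w"
      by (simp add: dist_real_def)
  qed simp
qed

text \<open>Every rectangle splits into rectangles on one side of the diagonal and at most one square
  centred on the diagonal.\<close>

lemma is_copulaI_triangles:
  assumes bd: "\<And>x. x \<in> II \<Longrightarrow> C x 0 = 0 \<and> C 0 x = 0 \<and> C x 1 = x \<and> C 1 x = x"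
    and upper: "\<And>a b c d. 0 \<le> a \<Longrightarrow> a \<le> b \<Longrightarrow> b \<le> c \<Longrightarrow> c \<le> d \<Longrightarrow> d \<le> 1 \<Longrightarrow>
      C b c + C a d \<le> C b d + C a c"
    and lower: "\<And>a b c d. 0 \<le> a \<Longrightarrow> a \<le> b \<Longrightarrow> b \<le> c \<Longrightarrow> c \<le> d \<Longrightarrow> d \<le> 1 \<Longrightarrow>
      C c b + C d a \<le> C d b + C c a"
    and square: "\<And>a b. 0 \<le> a \<Longrightarrow> a \<le> b \<Longrightarrow> b \<le> 1 \<Longrightarrow> C a b + C b a \<le> C a a + C b b"
  shows "is_copula C"
proof -
  have rect: "C b c + C a d \<le> C b d + C a c"
    if le: "0 \<le> a" "a \<le> b" "b \<le> 1" "0 \<le> c" "c \<le> d" "d \<le> 1" for a b c d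
  proof -
    consider "b \<le> c" | "d \<le> a" | "a \<le> c" "c \<le> b" "b \<le> d" | "a \<le> c" "c \<le> d" "d \<le> b"
      | "c \<le> a" "a \<le> b" "b \<le> d" | "c \<le> a" "a \<le> d" "d \<le> b"
      using le by fastforce
    then show ?thesis
    proof cases
      case 1
      then show ?thesis using upper le by blast
    next
      case 2
      then show ?thesis using lower[of c d a b] le by linarith
    next
      case 3
      then show ?thesis
        using upper[of a c c d] square[of c b] upper[of c b b d] le by linarith
    next
      case 4
      then show ?thesis
        using upper[of a c c d] square[of c d] lower[of c d d b] le by linarith
    next
      case 5
      then show ?thesis
        using lower[of c a a b] square[of a b] upper[of a b b d] le by linarith
    next
      case 6
      then show ?thesis
        using lower[of c a a b] square[of a d] lower[of a d d b] le by linarith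
    qed
  qed
  have "C x y \<in> II" if "x \<in> II" "y \<in> II" for x y
    using rect[of 0 x 0 y] rect[of 0 x y 1] bd[of x] bd[of y] bd[of 1] bd[of 0] that
    by (auto simp: II_def)
  moreover have "C b d + C a c - C b c - C a d \<ge> 0"
    if "a \<in> II" "b \<in> II" "c \<in> II" "d \<in> II" "a \<le> b" "c \<le> d" for a b c d
    using rect[of a b c d] that by (simp add: II_def)
  ultimately show ?thesis
    using bd unfolding is_copula_def by blast
qed

section \<open>The largest asymmetry at a point\<close>

locale diagonal_section =
  fixes \<delta> :: "real \<Rightarrow> real"
  assumes diagonal: "is_diagonal \<delta>"
begin

abbreviation d :: "real \<Rightarrow> real" where "d \<equiv> dhat \<delta>"

definition V :: "real \<Rightarrow> real" where "V x = total_var d 0 x"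

definition beta :: "real \<Rightarrow> real" where "beta y = y - (d y + V y) / 2"

definition eta :: "real \<Rightarrow> real" where "eta x = x + (d x - V x) / 2"

definition dmin :: "real \<Rightarrow> real \<Rightarrow> real" where "dmin x y = Inf (d ` {x..y})"

text \<open>The upper bound \<open>x + min 0 (beta y - eta x)\<close> for \<open>C x y\<close> minus
  the lower bound \<open>x - dmin x y\<close> for \<open>C y x\<close>.\<close>

definition gap :: "real \<Rightarrow> real \<Rightarrow> real" where
  "gap x y = dmin x y + min 0 (beta y - eta x)"

section \<open>Monotonicity and Lipschitz bounds for \<open>d\<close>, \<open>V\<close>,
  \<open>beta\<close> and \<open>eta\<close>\<close>

lemma d_nonneg: "x \<in> II \<Longrightarrow> 0 \<le> d x"
  using diagonal by (auto simp: is_diagonal_def dhat_def)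

lemma d_0 [simp]: "d 0 = 0"
  using diagonal by (force simp: is_diagonal_def dhat_def II_def)

lemma d_1 [simp]: "d 1 = 0"
  using diagonal by (auto simp: is_diagonal_def dhat_def)

lemma abs_d_diff_le:
  assumes "0 \<le> x" "x \<le> y" "y \<le> 1"
  shows "\<bar>d y - d x\<bar> \<le> y - x"
proof -
  have "0 \<le> \<delta> y - \<delta> x \<and> \<delta> y - \<delta> x \<le> 2 * (y - x)"
    using diagonal assms by (auto simp: is_diagonal_def II_def)
  then show ?thesis by (auto simp: dhat_def)
qed

lemma lipschitz_d: "1-lipschitz_on II d"
proof (rule lipschitz_onI)
  fix x y assume "x \<in> II" "y \<in> II"
  then show "dist (d x) (d y) \<le> 1 * dist x y"
    using abs_d_diff_le[of x y] abs_d_diff_le[of y x]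
    by (cases "x \<le> y") (auto simp: dist_real_def II_def)
qed simp

lemma lipschitz_d_interval:
  assumes "0 \<le> x" "y \<le> 1"
  shows "1-lipschitz_on {x..y} d"
  using lipschitz_on_subset[OF lipschitz_d, of "{x..y}"] assms by (auto simp: II_def)

lemma total_var_eq_V_diff:
  assumes "0 \<le> x" "x \<le> y" "y \<le> 1"
  shows "total_var d x y = V y - V x"
  unfolding V_def using total_var_additive[OF assms(1,2) lipschitz_d_interval] assms by simp

lemma TV_eq_V_diff:
  assumes "x \<in> II" "y \<in> II"
  shows "TV d x y = V y - V x"
  using assms total_var_eq_V_diff[of x y] total_var_eq_V_diff[of y x]
  by (auto simp: TV_def II_def)

lemma V_diff_bounds:
  assumes "0 \<le> x" "x \<le> y" "y \<le> 1"
  shows "\<bar>d y - d x\<bar> \<le> V y - V x" "V y - V x \<le> y - x"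
proof -
  note lip = lipschitz_d_interval[OF assms(1,3)]
  show "\<bar>d y - d x\<bar> \<le> V y - V x"
    using variation_sum_le_total_var[OF lip abs_diff_in_variation_sums] assms
    by (simp add: total_var_eq_V_diff)
  show "V y - V x \<le> y - x"
    using total_var_le[of x y d "y - x"] variation_sums_le[OF _ lip] assms
    by (simp add: total_var_eq_V_diff)
qed

lemma f_delta_eq:
  assumes "x \<in> II" "y \<in> II"
  shows "f_delta \<delta> x y = x + beta y - eta x"
  by (simp add: f_delta_def TV_eq_V_diff[OF assms] beta_def eta_def field_simps)

lemma eta_minus_beta: "eta x - beta x = d x"
  by (simp add: eta_def beta_def field_simps)

text \<open>With \<open>v = V y - V x\<close>, all three follow from
  \<open>\<bar>d y - d x\<bar> \<le> v \<le> y - x\<close>; the last one uses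
  \<open>y - x - v / 2 \<ge> v / 2\<close>.\<close>

lemma beta_diff_bounds:
  assumes "0 \<le> x" "x \<le> y" "y \<le> 1"
  shows "beta x \<le> beta y" "beta y - beta x \<le> y - x" "d x - d y \<le> beta y - beta x"
  using V_diff_bounds[OF assms] by (auto simp: beta_def abs_le_iff field_simps)

lemma eta_diff_bounds:
  assumes "0 \<le> x" "x \<le> y" "y \<le> 1"
  shows "eta x \<le> eta y" "eta y - eta x \<le> y - x"
  using V_diff_bounds[OF assms] by (auto simp: eta_def abs_le_iff field_simps)

lemma lipschitz_beta: "1-lipschitz_on II beta"
proof (rule lipschitz_onI)
  fix x y assume "x \<in> II" "y \<in> II"
  then show "dist (beta x) (beta y) \<le> 1 * dist x y"
    using beta_diff_bounds[of x y] beta_diff_bounds[of y x]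
    by (cases "x \<le> y") (auto simp: dist_real_def II_def)
qed simp

lemma lipschitz_eta: "1-lipschitz_on II eta"
proof (rule lipschitz_onI)
  fix x y assume "x \<in> II" "y \<in> II"
  then show "dist (eta x) (eta y) \<le> 1 * dist x y"
    using eta_diff_bounds[of x y] eta_diff_bounds[of y x]
    by (cases "x \<le> y") (auto simp: dist_real_def II_def)
qed simp

lemmas continuous_on_d = lipschitz_on_continuous_on[OF lipschitz_d]
lemmas continuous_on_beta = lipschitz_on_continuous_on[OF lipschitz_beta]
lemmas continuous_on_eta = lipschitz_on_continuous_on[OF lipschitz_eta]

section \<open>Minima of \<open>d\<close> over intervals\<close>

lemma dmin_attained:
  assumes "0 \<le> x" "x \<le> y" "y \<le> 1"
  obtains t where "x \<le> t" "t \<le> y" "dmin x y = d t"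
proof -
  have "continuous_on {x..y} d"
    using continuous_on_subset[OF continuous_on_d, of "{x..y}"] assms by (auto simp: II_def)
  then obtain t where t: "t \<in> {x..y}" "\<forall>s\<in>{x..y}. d t \<le> d s"
    using continuous_attains_inf[of "{x..y}" d] assms by auto
  then have "dmin x y = d t"
    unfolding dmin_def by (intro cInf_eq_minimum) auto
  then show thesis using that t by auto
qed

lemma dmin_le:
  assumes "0 \<le> x" "x \<le> t" "t \<le> y" "y \<le> 1"
  shows "dmin x y \<le> d t"
  unfolding dmin_def using assms d_nonneg
  by (intro cInf_lower bdd_belowI[of _ 0]) (auto simp: II_def)

lemma dmin_ge:
  assumes "0 \<le> x" "x \<le> y" "y \<le> 1" "\<And>t. x \<le> t \<Longrightarrow> t \<le> y \<Longrightarrow> c \<le> d t"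
  shows "c \<le> dmin x y"
  using dmin_attained[OF assms(1-3)] assms(4) by metis

lemma dmin_nonneg:
  assumes "0 \<le> x" "x \<le> y" "y \<le> 1"
  shows "0 \<le> dmin x y"
  using assms d_nonneg by (intro dmin_ge) (auto simp: II_def)

lemma dmin_refl:
  assumes "x \<in> II"
  shows "dmin x x = d x"
  using dmin_attained[of x x] assms by (force simp: II_def)

lemma dmin_antimono:
  assumes "0 \<le> x'" "x' \<le> x" "x \<le> y" "y \<le> y'" "y' \<le> 1"
  shows "dmin x' y' \<le> dmin x y"
  using assms by (intro dmin_ge dmin_le) auto

text \<open>The minimum over \<open>[a, e]\<close> is attained in \<open>[a, c]\<close> or in
  \<open>[b, e]\<close>; over the other of these two, the minimum is at most that over the
  subinterval \<open>[b, c]\<close>. This becomes the rectangle inequality below the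
  diagonal.\<close>

lemma dmin_overlap:
  assumes "0 \<le> a" "a \<le> b" "b \<le> c" "c \<le> e" "e \<le> 1"
  shows "dmin a c + dmin b e \<le> dmin b c + dmin a e"
proof -
  obtain t where t: "a \<le> t" "t \<le> e" "dmin a e = d t"
    using dmin_attained[of a e] assms by auto
  then have "dmin a c \<le> dmin a e \<or> dmin b e \<le> dmin a e"
    using dmin_le[of a t c] dmin_le[of b t e] assms by (cases "t \<le> c") auto
  then show ?thesis
    using dmin_antimono[of a b c c] dmin_antimono[of b b c e] assms by auto
qed

text \<open>Descending from \<open>d x\<close> to the minimum and climbing back to
  \<open>d y\<close> uses up variation. This becomes the square condition for
  \<open>extremal_copula\<close>.\<close>

lemma d_sum_le_V:
  assumes "0 \<le> x" "x \<le> y" "y \<le> 1"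
  shows "d x + d y \<le> V y - V x + 2 * dmin x y"
proof -
  obtain t where t: "x \<le> t" "t \<le> y" "dmin x y = d t"
    using dmin_attained assms by blast
  then show ?thesis
    using V_diff_bounds(1)[of x t] V_diff_bounds(1)[of t y] assms by simp
qed

lemma eta_0_le_beta: "y \<in> II \<Longrightarrow> eta 0 \<le> beta y"
  using beta_diff_bounds(1)[of 0 y] eta_minus_beta[of 0] by (auto simp: II_def)

lemma eta_le_beta_1: "x \<in> II \<Longrightarrow> eta x \<le> beta 1"
  using eta_diff_bounds[of x 1] eta_minus_beta[of 1] by (auto simp: II_def)

text \<open>Along a partition of \<open>[x, y]\<close>, the rectangle
  \<open>[x, u] \<times> [u, v]\<close> bounds the growth of \<open>C x\<close> by
  \<open>C u v - C u u\<close>; adding up the steps produces a variation sum of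
  \<open>d\<close>.\<close>

lemma copula_upper_bound:
  assumes C: "is_copula C" and diag: "\<And>t. t \<in> II \<Longrightarrow> C t t = \<delta> t"
    and xy: "0 \<le> x" "x \<le> y" "y \<le> 1"
  shows "C x y \<le> x + min 0 (beta y - eta x)"
proof -
  have lower: "C u v \<le> v - max (d u) (d v)" if uv: "0 \<le> u" "u \<le> v" "v \<le> 1" for u v
  proof -
    have "C u v \<le> C v v" "C u v - C u u \<le> v - u"
      using copula_lipschitz_fst[OF C, of u v v] copula_lipschitz_fst[OF copula_swap[OF C], of u v u] uv
      by (auto simp: II_def)
    then show ?thesis
      using diag[of u] diag[of v] uv by (auto simp: dhat_def II_def)
  qed
  have "z \<le> 1 \<longrightarrow> s \<le> 2 * (z - C x z) - d x - d z" if "s \<in> variation_sums d x z" for s z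
    using that
  proof (induction rule: variation_sums_induct)
    case refl
    show ?case using diag[of x] xy by (simp add: dhat_def II_def)
  next
    case (step u v s)
    show ?case
    proof
      assume v: "v \<le> 1"
      have "C u u + C x v \<le> C u v + C x u"
        using copula_rectangle[OF C, of x u u v] step v xy by auto
      moreover have "C u u = u - d u"
        using diag[of u] step v xy by (simp add: dhat_def II_def)
      \<comment> \<open>The step fits exactly, because
        \<open>2 * max (d u) (d v) - d u - d v = \<bar>d v - d u\<bar>\<close>.\<close>
      ultimately show "s + \<bar>d v - d u\<bar> \<le> 2 * (v - C x v) - d x - d v"
        using lower[of u v] step v xy by (auto simp: max_def abs_if split: if_splits)
    qed
  qed
  then have "V y - V x \<le> 2 * (y - C x y) - d x - d y"
    using total_var_le[OF xy(2)] xy by (simp flip: total_var_eq_V_diff)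
  moreover have "C x y \<le> x"
    using copula_lipschitz_fst(2)[OF C, of 0 x y] copula_boundary[OF C, of y] xy by (auto simp: II_def)
  ultimately show ?thesis
    by (auto simp: beta_def eta_def min_def field_simps)
qed

text \<open>Let \<open>t\<close> minimize \<open>d\<close> on \<open>[x, y]\<close>. Passing from
  \<open>(t, t)\<close> down to \<open>(t, x)\<close> loses at most \<open>t - x\<close>, which
  leaves \<open>x - d t\<close>; moving right to \<open>(y, x)\<close> loses nothing.\<close>

lemma copula_lower_bound:
  assumes C: "is_copula C" and diag: "\<And>t. t \<in> II \<Longrightarrow> C t t = \<delta> t"
    and xy: "0 \<le> x" "x \<le> y" "y \<le> 1"
  shows "x - dmin x y \<le> C y x"
proof -
  obtain t where t: "x \<le> t" "t \<le> y" "dmin x y = d t"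
    using dmin_attained xy by blast
  have "C t x \<le> C y x"
    using copula_lipschitz_fst(1)[OF C, of t y x] t xy by (auto simp: II_def)
  moreover have "C t t - C t x \<le> t - x"
    using copula_lipschitz_fst(2)[OF copula_swap[OF C], of x t t] t xy by (auto simp: II_def)
  ultimately show ?thesis
    using diag[of t] t xy by (auto simp: dhat_def II_def)
qed

text \<open>The bounds for \<open>C\<close> settle one sign of the difference; the transposed
  copula, with the same diagonal section, settles the other.\<close>

lemma copula_asymmetry_le_gap:
  assumes C: "is_copula C" and diag: "\<And>t. t \<in> II \<Longrightarrow> C t t = \<delta> t"
    and xy: "0 \<le> x" "x \<le> y" "y \<le> 1"
  shows "\<bar>C x y - C y x\<bar> \<le> gap x y"
  using copula_upper_bound[OF C diag xy] copula_lower_bound[OF C diag xy]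
    copula_upper_bound[OF copula_swap[OF C] diag xy] copula_lower_bound[OF copula_swap[OF C] diag xy]
  by (simp add: gap_def)

text \<open>The largest copula with diagonal section \<open>\<delta>\<close> above the diagonal, and the smallest one
  (the Bertino copula) below it.\<close>

definition extremal_copula :: "real \<Rightarrow> real \<Rightarrow> real" where
  "extremal_copula x y = (if x \<le> y then x + min 0 (beta y - eta x) else y - dmin y x)"

lemma extremal_copula_diag:
  assumes "t \<in> II"
  shows "extremal_copula t t = \<delta> t"
proof -
  have "beta t - eta t = - d t" "0 \<le> d t"
    using eta_minus_beta[of t] d_nonneg[OF assms] by auto
  then show ?thesis
    by (simp add: extremal_copula_def dhat_def)
qed

text \<open>The two branches of the definition agree on the diagonal, so the lower one is valid on
  the closed triangle.\<close>

lemma extremal_copula_below: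
  assumes "y \<in> II" "y \<le> x"
  shows "extremal_copula x y = y - dmin y x"
  using assms extremal_copula_diag[of y] dmin_refl[of y]
  by (cases "x = y") (auto simp: extremal_copula_def dhat_def)

text \<open>Above the diagonal, the rectangle inequality holds because \<open>min 0\<close> is
  concave and \<open>beta\<close>, \<open>eta\<close> are nondecreasing; below it is
  \<open>dmin_overlap\<close>, and squares are covered by \<open>d_sum_le_V\<close>.\<close>

lemma is_copula_extremal: "is_copula extremal_copula"
proof (rule is_copulaI_triangles)
  fix x assume x: "x \<in> II"
  have "dmin 0 x = 0" "dmin x 1 = 0"
    using x dmin_le[of 0 0 x] dmin_nonneg[of 0 x] dmin_le[of x 1 1] dmin_nonneg[of x 1]
    by (auto simp: II_def)
  then show "extremal_copula x 0 = 0 \<and> extremal_copula 0 x = 0 \<and>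
      extremal_copula x 1 = x \<and> extremal_copula 1 x = x"
    using x eta_0_le_beta[OF x] eta_le_beta_1[OF x] extremal_copula_below[of 0 x] extremal_copula_below[of x 1]
    by (auto simp: extremal_copula_def II_def)
next
  fix a b c e :: real assume "0 \<le> a" "a \<le> b" "b \<le> c" "c \<le> e" "e \<le> 1"
  then show "extremal_copula b c + extremal_copula a e \<le> extremal_copula b e + extremal_copula a c"
    using eta_diff_bounds(1)[of a b] beta_diff_bounds(1)[of c e]
    by (auto simp: extremal_copula_def min_def)
next
  fix a b c e :: real assume le: "0 \<le> a" "a \<le> b" "b \<le> c" "c \<le> e" "e \<le> 1"
  then show "extremal_copula c b + extremal_copula e a \<le> extremal_copula e b + extremal_copula c a"
    using dmin_overlap[OF le] by (simp add: extremal_copula_below II_def)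
next
  fix a b :: real assume le: "0 \<le> a" "a \<le> b" "b \<le> 1"
  have "extremal_copula a b \<le> a + beta b - eta a"
    using le by (simp add: extremal_copula_def)
  moreover have "extremal_copula b a = a - dmin a b"
    using le by (simp add: extremal_copula_below II_def)
  moreover have "extremal_copula a a = a - d a" "extremal_copula b b = b - d b"
    using le by (simp_all add: extremal_copula_diag dhat_def II_def)
  ultimately show "extremal_copula a b + extremal_copula b a \<le> extremal_copula a a + extremal_copula b b"
    using d_sum_le_V[OF le] by (simp add: beta_def eta_def field_simps)
qed

lemma extremal_copula_gap:
  assumes "0 \<le> x" "x \<le> y" "y \<le> 1"
  shows "extremal_copula x y - extremal_copula y x = gap x y"
  using assms extremal_copula_below[of x y] by (simp add: extremal_copula_def[of x y] gap_def II_def)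

section \<open>Attainment of the maximal gap and its equality with
  \<open>mu_diag \<delta>\<close>\<close>

definition triangle :: "(real \<times> real) set" where
  "triangle = {z \<in> II \<times> II. fst z \<le> snd z}"

lemma compact_triangle: "compact triangle"
proof -
  have "triangle = ({0..1} \<times> {0..1}) \<inter> {z. fst z \<le> snd z}"
    by (auto simp: triangle_def II_def)
  moreover have "closed {z :: real \<times> real. fst z \<le> snd z}"
    by (intro closed_Collect_le continuous_intros)
  ultimately show ?thesis
    by (metis compact_Icc compact_Int_closed compact_Times)
qed

text \<open>On the triangle the gap is \<open>extremal_copula\<close> minus its transpose, so it
  inherits the continuity of copulas.\<close>

lemma continuous_on_gap: "continuous_on triangle (\<lambda>z. gap (fst z) (snd z))"
proof -
  have "continuous_on triangle (\<lambda>z. extremal_copula (fst z) (snd z) - extremal_copula (snd z) (fst z))"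
    using continuous_on_copula[OF is_copula_extremal] continuous_on_copula[OF copula_swap[OF is_copula_extremal]]
    by (intro continuous_on_diff) (auto simp: triangle_def elim!: continuous_on_subset)
  then show ?thesis
    by (rule continuous_on_eq) (auto simp: triangle_def II_def extremal_copula_gap)
qed

lemma gap_maximum:
  obtains x y where "(x, y) \<in> triangle" "\<And>x' y'. (x', y') \<in> triangle \<Longrightarrow> gap x' y' \<le> gap x y"
proof -
  have "(0, 0) \<in> triangle" by (simp add: triangle_def II_def)
  then obtain z where "z \<in> triangle" "\<forall>w\<in>triangle. gap (fst w) (snd w) \<le> gap (fst z) (snd z)"
    using continuous_attains_sup[OF compact_triangle _ continuous_on_gap] by blast
  then show thesis
    using that[of "fst z" "snd z"] by force
qed

text \<open>The maximal gap bounds the asymmetry of every admissible copula, and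
  \<open>extremal_copula\<close> attains it at \<open>(x, y)\<close>.\<close>

lemma mu_diag_eq:
  assumes xy: "(x, y) \<in> triangle" and max: "\<And>x' y'. (x', y') \<in> triangle \<Longrightarrow> gap x' y' \<le> gap x y"
  shows "mu_diag \<delta> = gap x y"
proof -
  have le: "\<bar>C u v - C v u\<bar> \<le> gap x y"
    if C: "is_copula C" "\<forall>t\<in>II. C t t = \<delta> t" and uv: "u \<in> II" "v \<in> II" for C u v
  proof (cases "u \<le> v")
    case True
    then show ?thesis
      using copula_asymmetry_le_gap[of C u v] C uv max[of u v] by (force simp: triangle_def II_def)
  next
    case False
    then show ?thesis
      using copula_asymmetry_le_gap[of C v u] C uv max[of v u] by (force simp: triangle_def II_def)
  qed
  have asym_le: "asym C \<le> gap x y" if "is_copula C" "\<forall>t\<in>II. C t t = \<delta> t" for C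
    unfolding asym_def using le[OF that] xy by (intro cSup_least) (auto simp: triangle_def)
  have "gap x y \<le> asym extremal_copula"
    unfolding asym_def
  proof (rule cSup_upper2)
    show "\<bar>extremal_copula x y - extremal_copula y x\<bar>
        \<in> {\<bar>extremal_copula x y - extremal_copula y x\<bar> |x y. x \<in> II \<and> y \<in> II}"
      using xy by (auto simp: triangle_def)
    show "bdd_above {\<bar>extremal_copula x y - extremal_copula y x\<bar> |x y. x \<in> II \<and> y \<in> II}"
      using le[OF is_copula_extremal] extremal_copula_diag by (intro bdd_aboveI) auto
    show "gap x y \<le> \<bar>extremal_copula x y - extremal_copula y x\<bar>"
      using extremal_copula_gap[of x y] xy by (auto simp: triangle_def II_def)
  qed
  moreover have "is_copula extremal_copula \<and> (\<forall>t\<in>II. extremal_copula t t = \<delta> t)"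
    using is_copula_extremal extremal_copula_diag by blast
  ultimately have "asym extremal_copula = gap x y"
    using asym_le by (intro antisym) auto
  then show ?thesis
    unfolding mu_diag_def using asym_le is_copula_extremal extremal_copula_diag
    by (intro cSup_eq_maximum) force+
qed

section \<open>The maximum of the gap\<close>

lemma Df_open_iff:
  assumes "x \<in> II" "y \<in> II" "x \<le> y"
  shows "(x, y) \<in> Df_open \<delta> \<longleftrightarrow> beta y < eta x"
  using assms by (auto simp: Df_open_def f_delta_eq)

text \<open>The right-hand side is closed, contains \<open>Df_open \<delta>\<close>, and contains
  the diagonal since \<open>eta x - beta x = d x \<ge> 0\<close>.\<close>

lemma Df_subset: "Df \<delta> \<subseteq> {z \<in> II \<times> II. beta (snd z) \<le> eta (fst z)}" (is "_ \<subseteq> ?K")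
proof -
  have "closed (II \<times> II)"
    by (simp add: II_def closed_Times)
  then have "closed ?K"
    by (intro continuous_on_closed_Collect_le continuous_on_compose2[OF continuous_on_beta]
        continuous_on_compose2[OF continuous_on_eta] continuous_intros) auto
  moreover have "Df_open \<delta> \<subseteq> ?K"
    by (auto simp: Df_open_def f_delta_eq)
  ultimately have "closure (Df_open \<delta>) \<subseteq> ?K"
    by (simp add: closure_minimal)
  moreover have "beta x \<le> eta x" if "x \<in> II" for x
    using eta_minus_beta[of x] d_nonneg[OF that] by simp
  ultimately show ?thesis
    by (auto simp: Df_def)
qed

lemma compact_Df: "compact (Df \<delta>)"
proof -
  have "bounded (II \<times> II)"
    by (simp add: II_def bounded_Times)
  then have "bounded (Df \<delta>)"
    by (rule bounded_subset) (use Df_subset in auto)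
  moreover have "{(x, x) | x. x \<in> II} = (\<lambda>x. (x, x)) ` II"
    by auto
  then have "compact {(x, x) | x. x \<in> II}"
    by (simp add: II_def) (intro compact_continuous_image continuous_intros compact_Icc)
  then have "closed (Df \<delta>)"
    unfolding Df_def by (intro closed_Un closed_closure compact_imp_closed)
  ultimately show ?thesis
    by (simp add: compact_eq_bounded_closed)
qed

lemma Df_le_gU:
  assumes "(x, y) \<in> Df \<delta>"
  shows "y \<le> gU \<delta> x"
  unfolding gU_def using assms Df_subset
  by (intro cSup_upper bdd_aboveI[of _ 1]) (auto simp: II_def)

lemma gU_ge: "x \<in> II \<Longrightarrow> x \<le> gU \<delta> x"
  by (rule Df_le_gU) (auto simp: Df_def)

lemma gU_in_Df:
  assumes "x \<in> II"
  shows "(x, gU \<delta> x) \<in> Df \<delta>"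
proof -
  have "closed (Pair x -` Df \<delta>)"
    using compact_imp_closed[OF compact_Df] by (intro closed_vimage continuous_intros)
  moreover have "Pair x -` Df \<delta> = {y. (x, y) \<in> Df \<delta>}"
    by auto
  ultimately have "closed {y. (x, y) \<in> Df \<delta>}"
    by simp
  moreover have "x \<in> {y. (x, y) \<in> Df \<delta>}"
    using assms by (auto simp: Df_def)
  moreover have "bdd_above {y. (x, y) \<in> Df \<delta>}"
    using Df_subset by (intro bdd_aboveI[of _ 1]) (auto simp: II_def)
  ultimately show ?thesis
    using closed_contains_Sup[of "{y. (x, y) \<in> Df \<delta>}"] by (auto simp: gU_def)
qed

lemma gU_in_II: "x \<in> II \<Longrightarrow> gU \<delta> x \<in> II"
  using gU_in_Df Df_subset by fastforce

text \<open>One inequality is \<open>Df_subset\<close>. For the other, pairs just above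
  \<open>gU \<delta> x\<close> lie outside \<open>Df_open \<delta>\<close>, and \<open>beta\<close>
  is 1-Lipschitz; at the end point 1 it is \<open>eta_le_beta_1\<close>.\<close>

lemma beta_gU:
  assumes x: "x \<in> II"
  shows "beta (gU \<delta> x) = eta x"
proof (rule antisym)
  show "beta (gU \<delta> x) \<le> eta x"
    using gU_in_Df[OF x] Df_subset by fastforce
  show "eta x \<le> beta (gU \<delta> x)"
  proof (cases "gU \<delta> x = 1")
    case True
    then show ?thesis using eta_le_beta_1[OF x] by simp
  next
    case False
    then have lt: "0 \<le> gU \<delta> x" "gU \<delta> x < 1"
      using gU_in_II[OF x] by (auto simp: II_def)
    show ?thesis
    proof (rule field_le_epsilon)
      fix e :: real assume e: "0 < e"
      define y where "y = min 1 (gU \<delta> x + e)"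
      have y: "gU \<delta> x < y" "y \<le> 1" "y \<le> gU \<delta> x + e"
        using e lt by (auto simp: y_def)
      have "(x, y) \<notin> Df_open \<delta>"
        using Df_le_gU[of x y] y closure_subset by (force simp: Df_def)
      then have "eta x \<le> beta y"
        using Df_open_iff[of x y] x y lt gU_ge[OF x] by (auto simp: II_def)
      then show "eta x \<le> beta (gU \<delta> x) + e"
        using beta_diff_bounds(2)[of "gU \<delta> x" y] y lt by linarith
    qed
  qed
qed

lemma gU_gt:
  assumes "x \<in> II" "0 < d x"
  shows "x < gU \<delta> x"
  using gU_ge[OF assms(1)] beta_gU[OF assms(1)] eta_minus_beta[of x] assms(2)
  by (cases "gU \<delta> x = x") auto

text \<open>Otherwise some \<open>(s, t)\<close> in \<open>Df_open \<delta>\<close> near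
  \<open>(x, gU \<delta> x)\<close> has \<open>s < x'\<close> and \<open>t > gU \<delta> x'\<close>.
  As \<open>eta\<close> is nondecreasing, \<open>(x', t)\<close> is in
  \<open>Df_open \<delta>\<close> too, above \<open>gU \<delta> x'\<close>.\<close>

lemma gU_mono:
  assumes x: "x \<in> II" "x' \<in> II" "x < x'"
  shows "gU \<delta> x \<le> gU \<delta> x'"
proof (rule ccontr)
  assume "\<not> gU \<delta> x \<le> gU \<delta> x'"
  then have lt: "gU \<delta> x' < gU \<delta> x" by simp
  then have "x < gU \<delta> x"
    using gU_ge[OF x(2)] x(3) by simp
  then have "(x, gU \<delta> x) \<in> closure (Df_open \<delta>)"
    using gU_in_Df[OF x(1)] by (auto simp: Df_def)
  moreover have "open ({..<x'} \<times> {gU \<delta> x'<..})"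
    by (intro open_Times) auto
  moreover have "(x, gU \<delta> x) \<in> {..<x'} \<times> {gU \<delta> x'<..}"
    using x lt by auto
  ultimately obtain s t where st: "(s, t) \<in> Df_open \<delta>" "s < x'" "gU \<delta> x' < t"
    using open_Int_closure_eq_empty[of "{..<x'} \<times> {gU \<delta> x'<..}" "Df_open \<delta>"] by blast
  then have II: "s \<in> II" "t \<in> II"
    by (auto simp: Df_open_def)
  have "s \<le> t" "x' \<le> t"
    using st gU_ge[OF x(2)] by auto
  then have "beta t < eta x'"
    using Df_open_iff[OF II] st eta_diff_bounds(1)[of s x'] II x by (auto simp: II_def)
  then have "(x', t) \<in> Df_open \<delta>"
    using Df_open_iff[of x' t] II x \<open>x' \<le> t\<close> by auto
  then show False
    using Df_le_gU[of x' t] st closure_subset by (force simp: Df_def)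
qed

text \<open>The points over which \<open>Df \<delta>\<close> reaches height \<open>c\<close> form
  the projection of a compact set, and \<open>x\<close> is not among them.\<close>

lemma gU_upper_semicontinuous:
  assumes x: "x \<in> II" and c: "gU \<delta> x < c"
  shows "\<exists>e>0. \<forall>t\<in>II. \<bar>t - x\<bar> < e \<longrightarrow> gU \<delta> t < c"
proof -
  define K where "K = fst ` (Df \<delta> \<inter> {z. c \<le> snd z})"
  have "closed {z :: real \<times> real. c \<le> snd z}"
    by (intro closed_Collect_le continuous_intros)
  then have "compact K"
    unfolding K_def using compact_Df
    by (intro compact_continuous_image continuous_intros compact_Int_closed)
  then have "open (- K)"
    by (simp add: compact_imp_closed open_Compl)
  moreover have "x \<in> - K"
    using Df_le_gU c by (fastforce simp: K_def)
  ultimately obtain e where e: "e > 0" "\<And>t. dist t x < e \<Longrightarrow> t \<in> - K"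
    unfolding open_dist by blast
  have "gU \<delta> t < c" if t: "t \<in> II" "\<bar>t - x\<bar> < e" for t
  proof (rule ccontr)
    assume "\<not> gU \<delta> t < c"
    then have "t \<in> K"
      unfolding K_def using gU_in_Df[OF t(1)] by force
    then show False
      using e(2)[of t] t(2) by (simp add: dist_real_def)
  qed
  then show ?thesis using e(1) by blast
qed

lemma gap_gU:
  assumes "x \<in> II"
  shows "gap x (gU \<delta> x) = dmin x (gU \<delta> x)"
  by (simp add: gap_def beta_gU[OF assms])

text \<open>For fixed \<open>x\<close> the gap increases in \<open>y\<close> up to \<open>gU \<delta> x\<close>, since \<open>beta\<close> grows at
  least as fast as \<open>d\<close> falls, and decreases afterwards together with \<open>dmin\<close>.\<close>

lemma gap_le_gap_gU:
  assumes xy: "(x, y) \<in> triangle"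
  shows "gap x y \<le> gap x (gU \<delta> x)"
proof -
  have II: "x \<in> II" "y \<in> II" "x \<le> y" "0 \<le> x" "y \<le> 1" "0 \<le> y"
    using xy by (auto simp: triangle_def II_def)
  note G = gU_ge[OF II(1)] gU_in_II[OF II(1)]
  show ?thesis
  proof (cases "gU \<delta> x \<le> y")
    case True
    then have "dmin x y \<le> dmin x (gU \<delta> x)"
      using dmin_antimono[of x x "gU \<delta> x" y] II G by auto
    then show ?thesis
      by (simp add: gap_gU[OF II(1)]) (simp add: gap_def)
  next
    case False
    obtain t where t: "x \<le> t" "t \<le> gU \<delta> x" "dmin x (gU \<delta> x) = d t"
      using dmin_attained[of x "gU \<delta> x"] II G by (auto simp: II_def)
    have "beta y \<le> beta (gU \<delta> x)"
      using beta_diff_bounds(1)[of y "gU \<delta> x"] False II G by (auto simp: II_def)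
    then have "gap x y = dmin x y - (beta (gU \<delta> x) - beta y)"
      using beta_gU[OF II(1)] by (simp add: gap_def)
    also have "\<dots> \<le> d t"
    proof (cases "t \<le> y")
      case True
      then show ?thesis
        using dmin_le[of x t y] t II \<open>beta y \<le> beta (gU \<delta> x)\<close> by auto
    next
      case False
      then show ?thesis
        using dmin_le[of x y y] beta_diff_bounds(3)[of y t] beta_diff_bounds(1)[of t "gU \<delta> x"] t II G
        by (auto simp: II_def)
    qed
    finally show ?thesis
      using t(3) gap_gU[OF II(1)] by simp
  qed
qed

text \<open>Let \<open>(a, b)\<close> be the component of \<open>{d > 0}\<close> around
  \<open>z\<close>. A quarter of the way in, \<open>eta x < beta b\<close>, so \<open>beta\<close>
  takes the value \<open>eta x\<close> at some \<open>y < b\<close>, and the gap there is a minimum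
  of \<open>d\<close> over \<open>[x, y]\<close> inside \<open>(a, b)\<close>.\<close>

lemma gap_pos:
  assumes "z \<in> II" "d z \<noteq> 0"
  obtains x y where "(x, y) \<in> triangle" "0 < gap x y"
proof -
  have dz: "0 < d z" and z: "0 \<le> z" "z \<le> 1"
    using assms d_nonneg[of z] by (auto simp: II_def)
  have cont: "continuous_on {u..v} d" if "0 \<le> u" "v \<le> 1" for u v
    using continuous_on_subset[OF continuous_on_d, of "{u..v}"] that by (auto simp: II_def)
  define A where "A = {t \<in> {0..z}. d t \<le> 0}"
  define B where "B = {t \<in> {z..1}. d t \<le> 0}"
  have "closed A" "closed B"
    unfolding A_def B_def using z
    by (intro continuous_on_closed_Collect_le cont continuous_on_const closed_atLeastAtMost; simp)+
  moreover have ne: "0 \<in> A" "1 \<in> B"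
    using z by (auto simp: A_def B_def)
  moreover have bdd: "bdd_above A" "bdd_below B"
    by (auto simp: A_def B_def intro!: bdd_aboveI[of _ z] bdd_belowI[of _ z])
  ultimately have "Sup A \<in> A" "Inf B \<in> B"
    by (auto intro!: closed_contains_Sup closed_contains_Inf)
  define a b where "a = Sup A" and "b = Inf B"
  have a: "0 \<le> a" "a \<le> z" "d a = 0" and b: "z \<le> b" "b \<le> 1" "d b = 0"
    using \<open>Sup A \<in> A\<close> \<open>Inf B \<in> B\<close> d_nonneg[of a] d_nonneg[of b] z
    by (auto simp: a_def b_def A_def B_def II_def)
  have pos: "0 < d t" if "a < t" "t < b" for t
  proof (rule ccontr)
    assume "\<not> 0 < d t"
    then have "t \<in> A \<or> t \<in> B"
      using that a b by (auto simp: A_def B_def)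
    then show False
      using cSup_upper[OF _ bdd(1), of t] cInf_lower[OF _ bdd(2), of t] that by (auto simp: a_def b_def)
  qed
  have "a < b"
    using a b dz by (cases "a = z") auto
  have eta_b: "beta b = eta b"
    using eta_minus_beta[of b] b by simp
  \<comment> \<open>Since \<open>V b - V a \<le> b - a\<close>, \<open>eta\<close> grows by at least half of \<open>b - a\<close> on \<open>[a, b]\<close>.\<close>
  define x where "x = a + (b - a) / 4"
  have x: "a < x" "x < b" "x - a \<le> (b - a) / 4"
    using \<open>a < b\<close> by (auto simp: x_def field_simps)
  have "eta x < eta b"
    using eta_diff_bounds(2)[of a x] V_diff_bounds(2)[of a b] a b x by (auto simp: eta_def)
  then have "eta x < beta b" by (simp add: eta_b)
  moreover have "beta x \<le> eta x"
    using eta_minus_beta[of x] pos[OF x(1,2)] by simp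
  moreover have "continuous_on {x..b} beta"
    using continuous_on_subset[OF continuous_on_beta, of "{x..b}"] a b x by (auto simp: II_def)
  ultimately obtain y where y: "x \<le> y" "y \<le> b" "beta y = eta x"
    using IVT'[of beta x "eta x" b] x by auto
  then have "y < b"
    using \<open>eta x < beta b\<close> by (cases "y = b") auto
  obtain t where "x \<le> t" "t \<le> y" "dmin x y = d t"
    using dmin_attained[of x y] a b x y by auto
  then have "0 < dmin x y"
    using pos[of t] x \<open>y < b\<close> by simp
  then have "0 < gap x y"
    using y by (simp add: gap_def)
  moreover have "(x, y) \<in> triangle"
    using a b x y by (auto simp: triangle_def II_def)
  ultimately show thesis using that by blast
qed

section \<open>The function \<open>h_delta \<delta>\<close> and the set
  \<open>H_delta \<delta>\<close>\<close>

lemma d_ge_of_less_h: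
  assumes "x \<in> II" "x \<le> s" "s < h_delta \<delta> x"
  shows "d x \<le> d s"
proof -
  have "x \<in> {y \<in> II. y \<ge> x \<and> (\<forall>t\<in>{x..y}. d t \<ge> d x)}"
    using assms by auto
  then obtain y where "y \<in> {y \<in> II. y \<ge> x \<and> (\<forall>t\<in>{x..y}. d t \<ge> d x)}" "s < y"
    using less_cSupE[OF assms(3)[unfolded h_delta_def]] by blast
  then show ?thesis using assms by auto
qed

lemma le_h:
  assumes "x \<in> II" "y \<in> II" "x \<le> y" "\<And>t. x \<le> t \<Longrightarrow> t \<le> y \<Longrightarrow> d x \<le> d t"
  shows "y \<le> h_delta \<delta> x"
  unfolding h_delta_def using assms
  by (intro cSup_upper bdd_aboveI[of _ 1]) (auto simp: II_def)

text \<open>The supremum only controls points strictly below \<open>h_delta \<delta> x\<close>; the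
  Lipschitz bound on \<open>d\<close> extends this to the end point.\<close>

lemma d_le_dmin_of_le_h:
  assumes x: "x \<in> II" and y: "y \<in> II" "x \<le> y" "y \<le> h_delta \<delta> x"
  shows "d x \<le> dmin x y"
proof (rule dmin_ge)
  fix t assume t: "x \<le> t" "t \<le> y"
  show "d x \<le> d t"
  proof (rule field_le_epsilon)
    fix e :: real assume e: "0 < e"
    define s where "s = max x (t - e)"
    have s: "x \<le> s" "s \<le> t" "t - s \<le> e" "s < h_delta \<delta> x \<or> s = x"
      using t e y by (auto simp: s_def)
    then have "d x \<le> d s"
      using d_ge_of_less_h[OF x, of s] by auto
    then show "d x \<le> d t + e"
      using abs_d_diff_le[of s t] s t x y by (auto simp: II_def)
  qed
qed (use x y in \<open>auto simp: II_def\<close>)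

lemma H_delta_le_h:
  assumes "(x, y) \<in> H_delta \<delta>"
  shows "y \<le> h_delta \<delta> x"
  using assms by (auto simp: H_delta_def)

text \<open>At a continuity point the lower limit equals \<open>h_delta \<delta> x\<close>, which
  forces \<open>y\<close> onto the graph; otherwise \<open>x\<close> is in
  \<open>Z_delta \<delta>\<close>.\<close>

lemma H_delta_of_liminf:
  assumes x: "x \<in> II" and y: "liminf_h \<delta> x \<le> y" "y \<le> h_delta \<delta> x"
    and nt: "at x within II \<noteq> bot"
  shows "(x, y) \<in> H_delta \<delta>"
proof (cases "y = h_delta \<delta> x")
  case True
  then show ?thesis using x by (auto simp: H_delta_def)
next
  case False
  have "\<not> continuous (at x within II) (h_delta \<delta>)"
  proof
    assume "continuous (at x within II) (h_delta \<delta>)"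
    then have "((\<lambda>t. ereal (h_delta \<delta> t)) \<longlongrightarrow> ereal (h_delta \<delta> x)) (at x within II)"
      by (simp add: continuous_within)
    from lim_imp_Liminf[OF nt this] have "liminf_h \<delta> x = h_delta \<delta> x"
      by (simp add: liminf_h_def)
    then show False using False y by simp
  qed
  then have "x \<in> Z_delta \<delta>"
    using x by (simp add: Z_delta_def)
  then show ?thesis
    using y by (auto simp: H_delta_def)
qed

text \<open>\<open>real_of_ereal\<close> sends infinite values to 0, which cannot exceed
  \<open>c \<ge> 0\<close>; hence the lower limit is finite here.\<close>

lemma eventually_h_gt:
  assumes "0 \<le> c" "c < liminf_h \<delta> x"
  shows "eventually (\<lambda>t. c < h_delta \<delta> t) (at x within II)"
proof -
  define l where "l = Liminf (at x within II) (\<lambda>t. ereal (h_delta \<delta> t))"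
  have "c < real_of_ereal l"
    using assms(2) by (simp add: liminf_h_def l_def)
  then have "ereal c < l"
    using assms(1) by (cases l) auto
  then have "eventually (\<lambda>t. ereal c < ereal (h_delta \<delta> t)) (at x within II)"
    unfolding l_def by (rule less_LiminfD)
  then show ?thesis by simp
qed

text \<open>Moving the left end of an optimal pair down to the level \<open>gap x0 y0\<close> of \<open>d\<close> keeps the pair
  optimal, because \<open>gU\<close> is monotone.\<close>

lemma maximal_gap_on_level:
  assumes xy: "(x0, y0) \<in> triangle" and max: "\<And>x y. (x, y) \<in> triangle \<Longrightarrow> gap x y \<le> gap x0 y0"
    and pos: "0 < gap x0 y0"
  obtains x y where "(x, y) \<in> triangle" "d x = gap x0 y0" "gap x y = gap x0 y0"
proof -
  define \<mu> where "\<mu> = gap x0 y0"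
  have x0: "x0 \<in> II" "0 \<le> x0" "x0 \<le> 1"
    using xy by (auto simp: triangle_def II_def)
  have G0: "x0 \<le> gU \<delta> x0" "gU \<delta> x0 \<le> 1"
    using gU_ge[OF x0(1)] gU_in_II[OF x0(1)] by (auto simp: II_def)
  have dmin0: "\<mu> \<le> dmin x0 (gU \<delta> x0)"
    using gap_le_gap_gU[OF xy] gap_gU[OF x0(1)] by (simp add: \<mu>_def)
  then have d0: "\<mu> \<le> d x0"
    using dmin_le[of x0 x0 "gU \<delta> x0"] x0 G0 by simp
  have cont: "continuous_on {u..v} d" if "0 \<le> u" "v \<le> 1" for u v
    using continuous_on_subset[OF continuous_on_d, of "{u..v}"] that by (auto simp: II_def)
  \<comment> \<open>\<open>Sup A\<close> is the last point up to \<open>x0\<close> where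
    \<open>d\<close> is at most \<mu>; the intermediate value theorem then makes \<open>d\<close>
    equal to \<mu> there.\<close>
  define A where "A = {t \<in> {0..x0}. d t \<le> \<mu>}"
  have "closed A"
    unfolding A_def using x0
    by (intro continuous_on_closed_Collect_le cont continuous_on_const closed_atLeastAtMost; simp)
  moreover have "0 \<in> A"
    using x0 pos by (simp add: A_def \<mu>_def)
  moreover have bdd: "bdd_above A"
    by (auto simp: A_def intro!: bdd_aboveI[of _ x0])
  ultimately have "Sup A \<in> A"
    by (auto intro!: closed_contains_Sup)
  define x where "x = Sup A"
  have x: "0 \<le> x" "x \<le> x0" "d x \<le> \<mu>"
    using \<open>Sup A \<in> A\<close> by (auto simp: x_def A_def)
  have above: "\<mu> < d t" if "x < t" "t \<le> x0" for t
    using cSup_upper[OF _ bdd, of t] that x by (force simp: x_def A_def)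
  obtain t where "x \<le> t" "t \<le> x0" "d t = \<mu>"
    using IVT'[of d x \<mu> x0] x d0 x0 cont[of x x0] by auto
  then have dx: "d x = \<mu>"
    using above[of t] by (cases "x = t") auto
  have xI: "x \<in> II"
    using x x0 by (simp add: II_def)
  have "gU \<delta> x \<le> gU \<delta> x0"
    using gU_mono[OF xI x0(1)] x(2) by (cases "x = x0") auto
  \<comment> \<open>Up to \<open>x0\<close> this is the choice of \<open>x\<close>; beyond
    \<open>x0\<close>, the monotonicity of \<open>gU\<close> keeps \<open>t\<close> inside
    \<open>[x0, gU \<delta> x0]\<close>.\<close>
  have "\<mu> \<le> dmin x (gU \<delta> x)"
  proof (rule dmin_ge)
    fix t assume t: "x \<le> t" "t \<le> gU \<delta> x"
    show "\<mu> \<le> d t"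
    proof (cases "t \<le> x0")
      case True
      then show ?thesis using above[of t] dx t by (cases "t = x") auto
    next
      case False
      then show ?thesis
        using dmin_le[of x0 t "gU \<delta> x0"] dmin0 t \<open>gU \<delta> x \<le> gU \<delta> x0\<close> x0 G0 by simp
    qed
  qed (use x gU_ge[OF xI] gU_in_II[OF xI] in \<open>auto simp: II_def\<close>)
  moreover have tri: "(x, gU \<delta> x) \<in> triangle"
    using xI gU_ge[OF xI] gU_in_II[OF xI] by (simp add: triangle_def)
  ultimately have "gap x (gU \<delta> x) = \<mu>"
    using max[OF tri] gap_gU[OF xI] by (simp add: \<mu>_def)
  then show thesis
    using that[OF tri] dx by (simp add: \<mu>_def)
qed

text \<open>The rightmost optimal \<open>x\<close> with \<open>d x\<close> equal to the maximal gap lies on \<open>H_delta\<close>: if the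
  lower limit of \<open>h_delta\<close> exceeded \<open>gU \<delta> x\<close>, points slightly to the right would also be optimal.\<close>

lemma maximal_gap_on_H:
  assumes xy: "(x0, y0) \<in> triangle" and max: "\<And>x y. (x, y) \<in> triangle \<Longrightarrow> gap x y \<le> gap x0 y0"
    and pos: "0 < gap x0 y0"
  obtains x where "x \<in> II" "d x = gap x0 y0" "(x, gU \<delta> x) \<in> H_delta \<delta>" "x < gU \<delta> x"
proof -
  define \<mu> where "\<mu> = gap x0 y0"
  \<comment> \<open>The optimal pairs with \<open>d\<close> at level \<mu>; by compactness their
    first coordinates have a largest element.\<close>
  define K where "K = {z \<in> triangle. d (fst z) = \<mu>} \<inter> {z \<in> triangle. gap (fst z) (snd z) = \<mu>}"
  have "continuous_on triangle (\<lambda>z. d (fst z))"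
    by (rule continuous_on_compose2[OF continuous_on_d])
      (auto intro!: continuous_intros simp: triangle_def)
  then have "closed K"
    unfolding K_def using continuous_on_gap compact_imp_closed[OF compact_triangle]
    by (intro closed_Int continuous_closed_preimage_constant)
  then have "compact (triangle \<inter> K)"
    by (rule compact_Int_closed[OF compact_triangle])
  moreover have "triangle \<inter> K = K"
    by (auto simp: K_def)
  ultimately have "compact (fst ` K)"
    by (intro compact_continuous_image continuous_intros) simp
  moreover obtain x1 y1 where "(x1, y1) \<in> triangle" "d x1 = \<mu>" "gap x1 y1 = \<mu>"
    using maximal_gap_on_level[OF xy _ pos] max unfolding \<mu>_def by blast
  then have "(x1, y1) \<in> K"
    by (simp add: K_def)
  then have "fst ` K \<noteq> {}"
    by blast
  ultimately obtain x where "x \<in> fst ` K" and top: "\<And>t. t \<in> fst ` K \<Longrightarrow> t \<le> x"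
    using compact_attains_sup[of "fst ` K"] by auto
  then obtain y where y: "(x, y) \<in> triangle" "d x = \<mu>" "gap x y = \<mu>"
    by (auto simp: K_def)
  have x: "x \<in> II" "0 \<le> x" "x \<le> 1"
    using y by (auto simp: triangle_def II_def)
  have tri: "(t, gU \<delta> t) \<in> triangle" if "t \<in> II" for t
    using that gU_ge[OF that] gU_in_II[OF that] by (simp add: triangle_def)
  have G: "x < gU \<delta> x" "gU \<delta> x \<le> 1"
    using gU_gt[OF x(1)] gU_in_II[OF x(1)] pos y by (auto simp: \<mu>_def II_def)
  have dmin: "d x \<le> dmin x (gU \<delta> x)"
    using gap_le_gap_gU[OF y(1)] gap_gU[OF x(1)] y by simp
  then have d_ge: "d x \<le> d t" if "x \<le> t" "t \<le> gU \<delta> x" for t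
    using dmin_le[of x t "gU \<delta> x"] that x G by simp
  then have "gU \<delta> x \<le> h_delta \<delta> x"
    using le_h[of x "gU \<delta> x"] x G by (auto simp: II_def)
  moreover have "liminf_h \<delta> x \<le> gU \<delta> x"
  proof (rule ccontr)
    assume "\<not> liminf_h \<delta> x \<le> gU \<delta> x"
    then obtain c where c: "gU \<delta> x < c" "c < liminf_h \<delta> x"
      using dense not_le by metis
    obtain e1 where e1: "e1 > 0" "\<And>t. t \<in> II \<Longrightarrow> \<bar>t - x\<bar> < e1 \<Longrightarrow> gU \<delta> t < c"
      using gU_upper_semicontinuous[OF x(1) c(1)] by blast
    have "eventually (\<lambda>t. c < h_delta \<delta> t) (at x within II)"
      using eventually_h_gt c G x by simp
    then obtain e2 where e2: "e2 > 0"
      "\<And>t. t \<in> II \<Longrightarrow> t \<noteq> x \<Longrightarrow> \<bar>t - x\<bar> < e2 \<Longrightarrow> c < h_delta \<delta> t"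
      by (auto simp: eventually_at dist_real_def)
    define t where "t = x + min (gU \<delta> x - x) (min e1 e2) / 2"
    have t: "x < t" "t < gU \<delta> x" "\<bar>t - x\<bar> < e1" "\<bar>t - x\<bar> < e2"
      using e1(1) e2(1) G by (auto simp: t_def min_def field_simps)
    have tI: "t \<in> II"
      using t x G by (simp add: II_def)
    have "gU \<delta> t < h_delta \<delta> t"
      using e1(2)[OF tI t(3)] e2(2)[OF tI _ t(4)] t by simp
    then have "d t \<le> gap t (gU \<delta> t)"
      using d_le_dmin_of_le_h[OF tI gU_in_II[OF tI] gU_ge[OF tI]] gap_gU[OF tI] by simp
    \<comment> \<open>Since \<open>t\<close> lies in \<open>[x, gU \<delta> x]\<close>,
      \<open>\<mu> \<le> d t \<le> gap t (gU \<delta> t) \<le> \<mu>\<close>, so \<open>t\<close> is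
      an optimal point to the right of \<open>x\<close>.\<close>
    then have "d t = \<mu>" "gap t (gU \<delta> t) = \<mu>"
      using max[OF tri[OF tI]] d_ge[of t] t y by (auto simp: \<mu>_def)
    then have "(t, gU \<delta> t) \<in> K"
      using tri[OF tI] by (simp add: K_def)
    then show False
      using top[of t] t(1) by force
  qed
  moreover have "at x within II \<noteq> bot"
    unfolding II_def using x by (simp add: at_within_Icc_at trivial_limit_within islimpt_Icc)
  ultimately have "(x, gU \<delta> x) \<in> H_delta \<delta>"
    using H_delta_of_liminf[OF x(1)] by simp
  then show thesis
    using that x(1) y(2) G(1) unfolding \<mu>_def by simp
qed

end

theorem theorem4p8:
  fixes \<delta> :: "real \<Rightarrow> real"
  assumes "is_diagonal \<delta>"
    and "\<exists>x\<in>II. \<delta> x \<noteq> x"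
  defines "S \<equiv> {dhat \<delta> x | x. x \<in> II \<and> (x, gU \<delta> x) \<in> H_delta \<delta> \<and> gU \<delta> x > x}"
  shows "mu_diag \<delta> \<in> S \<and> (\<forall>s\<in>S. s \<le> mu_diag \<delta>)"
proof -
  interpret diagonal_section \<delta>
    by (unfold_locales) (rule assms(1))
  obtain x0 y0 where xy: "(x0, y0) \<in> triangle"
    and max: "\<And>x y. (x, y) \<in> triangle \<Longrightarrow> gap x y \<le> gap x0 y0"
    using gap_maximum by blast
  then have mu: "mu_diag \<delta> = gap x0 y0"
    by (rule mu_diag_eq)
  obtain z where "z \<in> II" "d z \<noteq> 0"
    using assms(2) by (auto simp: dhat_def)
  then obtain x1 y1 where "(x1, y1) \<in> triangle" "0 < gap x1 y1"
    by (rule gap_pos)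
  then have "0 < gap x0 y0"
    using max[of x1 y1] by simp
  then obtain x where x: "x \<in> II" "d x = gap x0 y0" "(x, gU \<delta> x) \<in> H_delta \<delta>" "x < gU \<delta> x"
    using maximal_gap_on_H[OF xy] max by blast
  then have "mu_diag \<delta> \<in> S"
    unfolding S_def mu by force
  moreover have "s \<le> mu_diag \<delta>" if s: "s \<in> S" for s
  proof -
    obtain x where x: "s = d x" "x \<in> II" "(x, gU \<delta> x) \<in> H_delta \<delta>" "x < gU \<delta> x"
      using s by (auto simp: S_def)
    \<comment> \<open>Points of \<open>H_delta \<delta>\<close> lie on or below the graph of
      \<open>h_delta \<delta>\<close>, so \<open>d\<close> is at least \<open>d x\<close> on all of
      \<open>[x, gU \<delta> x]\<close>.\<close>
    then have "d x \<le> gap x (gU \<delta> x)"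
      using d_le_dmin_of_le_h[OF x(2) gU_in_II[OF x(2)]] H_delta_le_h[OF x(3)] gap_gU[OF x(2)] by simp
    also have "\<dots> \<le> gap x0 y0"
      using max[of x "gU \<delta> x"] x gU_in_II[OF x(2)] by (simp add: triangle_def)
    finally show ?thesis
      using x(1) mu by simp
  qed
  ultimately show ?thesis by blast
qed

end
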